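(* Let $A \in \mathbb{R}^{m\times n}$ be a totally unimodular matrix, let $k \in \{1,\dots,m\}$ and $\mathcal{I} \subset \{1,\dots,m\}$ be given, and let $\bar{\mathcal{I}} = \{1,\dots,m\}\setminus \mathcal{I}$. Consider the cardinality minimization problem $$(\mathrm{P}_0)\qquad \min_{x \in \mathbb{R}^n} \ \|A(\bar{\mathcal{I}},:)x\|_0 \quad \text{subject to} \quad A(k,:)x = 1,\quad A(\mathcal{I},:)x = 0,$$ and the standard form linear program $$(\mathrm{LP})\qquad \min_{x_+,x_-,y_+,y_-} \ \sum_{j=1}^{|\bar{\mathcal{I}}|}\big(y_+(j)+y_-(j)\big)$$ subject to $$A(\bar{\mathcal{I}},:)(x_+-x_-) = y_+-y_-,\quad A(k,:)(x_+-x_-) = 1,\quad A(\mathcal{I},:)(x_+-x_-)=0,$$ $$x_+\in\mathbb{R}^n_+,\ x_-\in\mathbb{R}^n_+,\ y_+\in\mathbb{R}^{|\bar{\mathcal{I}}|}_+,\ y_-\in\mathbb{R}^{|\bar{\mathcal{I}}|}_+ .$$ Let $(x_+^\star,x_-^\star,y_+^\star,y_-^\star)$ be an optimal basic feasible solution to $(\mathrm{LP})$. Then $x^\star \triangleq x_+^\star - x_-^\star$ is an optimal solution to $(\mathrm{P}_0)$.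
   Context: Notation: $\|v\|_0$ is the number of nonzero entries of the vector $v$; $|\mathcal{S}|$ is the cardinality of an index set $\mathcal{S}$; $A(k,:)$ is the $k$-th row of $A$; $A(\mathcal{S},:)$ is the submatrix of $A$ formed by the rows indexed by $\mathcal{S}$; $\mathbb{R}_+^p$ is the set of entrywise nonnegative vectors in $\mathbb{R}^p$. If $\mathcal{I}=\emptyset$, the constraint involving $A(\mathcal{I},:)$ is ignored. A matrix is totally unimodular if the determinant of every square submatrix is $-1$, $0$ or $1$. A polyhedron in $\mathbb{R}^p$ is a subset of $\mathbb{R}^p$ described by (finitely many) linear equality and inequality constraints. A basic solution of a polyhedron in $\mathbb{R}^p$ is a vector satisfying all equality constraints and such that, out of all constraints active at it, $p$ of them are linearly independent. A basic feasible solution is a basic solution that is also feasible (lies in the polyhedron). A basic feasible solution to a linear program is a basic feasible solution of the polyhedron defining its feasible set; it is an optimal basic feasible solution if it is moreover an optimal solution of the linear program. For $(\mathrm{LP})$, the polyhedron lies in $\mathbb{R}^{2n+2|\bar{\mathcal{I}}|}$, with the equality constraints and nonnegativity constraints listed. *)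

theory Defs
  imports
    "Jordan_Normal_Form.VS_Connect"
    "Jordan_Normal_Form.DL_Submatrix"
begin

text \<open>Indices run from 0, so \<open>{1..m}\<close> of the usual mathematical notation is \<open>{..<m}\<close> here.\<close>

definition totally_unimodular :: "real mat \<Rightarrow> bool" where
  "totally_unimodular A \<longleftrightarrow>
    (\<forall>R C. R \<subseteq> {..<dim_row A} \<longrightarrow> C \<subseteq> {..<dim_col A} \<longrightarrow> card R = card C \<longrightarrow>
       det (submatrix A R C) \<in> {-1, 0, 1})"

definition norm0 :: "real vec \<Rightarrow> nat" where
  "norm0 v = card {i. i < dim_vec v \<and> v $ i \<noteq> 0}"

definition row_submatrix :: "real mat \<Rightarrow> nat set \<Rightarrow> real mat" where
  "row_submatrix A S = submatrix A S UNIV"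


section \<open>Polyhedra and basic feasible solutions\<close>

text \<open>
  A linear constraint is a pair \<open>(a, b)\<close> of a coefficient vector and a right-hand side. A polyhedron
  in \<open>\<real>\<^sup>p\<close> is described by a set \<open>E\<close> of equality constraints \<open>a \<bullet> x = b\<close> and a set \<open>N\<close> of inequality
  constraints \<open>a \<bullet> x \<ge> b\<close>, both finite. Being a basic solution depends on the description \<open>(E, N)\<close>
  and not only on the set of points described.
\<close>

type_synonym constr = "real vec \<times> real"

definition polyhedron :: "nat \<Rightarrow> constr set \<Rightarrow> constr set \<Rightarrow> real vec set" where
  "polyhedron p E N = {x \<in> carrier_vec p. (\<forall>(a, b) \<in> E. a \<bullet> x = b) \<and> (\<forall>(a, b) \<in> N. a \<bullet> x \<ge> b)}"

definition active_constrs :: "constr set \<Rightarrow> constr set \<Rightarrow> real vec \<Rightarrow> constr set" where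
  "active_constrs E N x = {(a, b) \<in> E \<union> N. a \<bullet> x = b}"

definition lin_indep_constrs :: "nat \<Rightarrow> constr set \<Rightarrow> bool" where
  "lin_indep_constrs p B \<longleftrightarrow>
     inj_on fst B \<and> \<not> module.lin_dep class_ring (module_vec TYPE(real) p) (fst ` B)"

definition basic_solution :: "nat \<Rightarrow> constr set \<Rightarrow> constr set \<Rightarrow> real vec \<Rightarrow> bool" where
  "basic_solution p E N x \<longleftrightarrow>
     x \<in> carrier_vec p \<and> (\<forall>(a, b) \<in> E. a \<bullet> x = b) \<and>
     (\<exists>B \<subseteq> active_constrs E N x. finite B \<and> card B = p \<and> lin_indep_constrs p B)"

definition basic_feasible_solution :: "nat \<Rightarrow> constr set \<Rightarrow> constr set \<Rightarrow> real vec \<Rightarrow> bool" where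
  "basic_feasible_solution p E N x \<longleftrightarrow> basic_solution p E N x \<and> x \<in> polyhedron p E N"


section \<open>The cardinality minimization problem\<close>

definition P0_feasible :: "real mat \<Rightarrow> nat \<Rightarrow> nat set \<Rightarrow> real vec \<Rightarrow> bool" where
  "P0_feasible A k I x \<longleftrightarrow>
     x \<in> carrier_vec (dim_col A) \<and> row A k \<bullet> x = 1 \<and> row_submatrix A I *\<^sub>v x = 0\<^sub>v (card I)"

definition P0_optimal :: "real mat \<Rightarrow> nat \<Rightarrow> nat set \<Rightarrow> real vec \<Rightarrow> bool" where
  "P0_optimal A k I =
     is_arg_min (\<lambda>x. norm0 (row_submatrix A ({..<dim_row A} - I) *\<^sub>v x)) (P0_feasible A k I)"


section \<open>The linear program\<close>

definition LP_feasible ::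
  "real mat \<Rightarrow> nat \<Rightarrow> nat set \<Rightarrow> real vec \<times> real vec \<times> real vec \<times> real vec \<Rightarrow> bool" where
  "LP_feasible A k I = (\<lambda>(xp, xm, yp, ym).
     let n = dim_col A; J = {..<dim_row A} - I; q = card J in
       row_submatrix A J *\<^sub>v (xp - xm) = yp - ym \<and>
       row A k \<bullet> (xp - xm) = 1 \<and>
       row_submatrix A I *\<^sub>v (xp - xm) = 0\<^sub>v (card I) \<and>
       xp \<in> carrier_vec n \<and> 0\<^sub>v n \<le> xp \<and> xm \<in> carrier_vec n \<and> 0\<^sub>v n \<le> xm \<and>
       yp \<in> carrier_vec q \<and> 0\<^sub>v q \<le> yp \<and> ym \<in> carrier_vec q \<and> 0\<^sub>v q \<le> ym)"

definition LP_objective ::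
  "real mat \<Rightarrow> nat set \<Rightarrow> real vec \<times> real vec \<times> real vec \<times> real vec \<Rightarrow> real" where
  "LP_objective A I = (\<lambda>(xp, xm, yp, ym). \<Sum>j < card ({..<dim_row A} - I). yp $ j + ym $ j)"

text \<open>
  The same constraints as a description of a polyhedron in \<open>\<real>\<^sup>p\<close> with \<open>p = 2n + 2q\<close>, the variables
  being stacked as \<open>(x\<^sub>+, x\<^sub>-, y\<^sub>+, y\<^sub>-)\<close>; lemma \<open>LP_polyhedron_iff\<close> shows that the two agree.
\<close>

definition LP_dim :: "real mat \<Rightarrow> nat set \<Rightarrow> nat" where
  "LP_dim A I = 2 * dim_col A + 2 * card ({..<dim_row A} - I)"

definition LP_stack :: "real vec \<times> real vec \<times> real vec \<times> real vec \<Rightarrow> real vec" where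
  "LP_stack = (\<lambda>(xp, xm, yp, ym). (xp @\<^sub>v xm) @\<^sub>v (yp @\<^sub>v ym))"

definition LP_coeffs :: "real vec \<Rightarrow> real vec \<Rightarrow> real vec" where
  "LP_coeffs r s = LP_stack (r, - r, - s, s)"

definition LP_eqs :: "real mat \<Rightarrow> nat \<Rightarrow> nat set \<Rightarrow> constr set" where
  "LP_eqs A k I = (let J = {..<dim_row A} - I; q = card J in
     {(LP_coeffs (row (row_submatrix A J) j) (unit_vec q j), 0) | j. j < q} \<union>
     {(LP_coeffs (row A k) (0\<^sub>v q), 1)} \<union>
     {(LP_coeffs (row (row_submatrix A I) i) (0\<^sub>v q), 0) | i. i < card I})"

definition LP_ineqs :: "real mat \<Rightarrow> nat set \<Rightarrow> constr set" where
  "LP_ineqs A I = {(unit_vec (LP_dim A I) j, 0) | j. j < LP_dim A I}"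

definition LP_optimal_bfs ::
  "real mat \<Rightarrow> nat \<Rightarrow> nat set \<Rightarrow> real vec \<times> real vec \<times> real vec \<times> real vec \<Rightarrow> bool" where
  "LP_optimal_bfs A k I z \<longleftrightarrow>
     basic_feasible_solution (LP_dim A I) (LP_eqs A k I) (LP_ineqs A I) (LP_stack z) \<and>
     is_arg_min (LP_objective A I) (LP_feasible A k I) z"


subsection \<open>The two descriptions of the feasible set agree\<close>

lemma row_submatrix_carrier:
  assumes "S \<subseteq> {..<dim_row A}"
  shows "row_submatrix A S \<in> carrier_mat (card S) (dim_col A)"
proof -
  have "{i. i < dim_row A \<and> i \<in> S} = S" using assms by auto
  moreover have "{j. j < dim_col A \<and> j \<in> UNIV} = {..<dim_col A}" by auto
  ultimately show ?thesis
    unfolding row_submatrix_def by (intro carrier_matI) (simp_all add: dim_submatrix)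
qed

lemma row_submatrix_row:
  assumes "S \<subseteq> {..<dim_row A}" and "i < card S"
  shows "row (row_submatrix A S) i = row A (pick S i)"
proof -
  have S: "{i. i < dim_row A \<and> i \<in> S} = S" using assms by auto
  have fin: "finite S" using assms(1) finite_subset by blast
  have p: "pick S i \<in> S" using assms(2) by (rule pick_in_set_le)
  with assms(1) have p': "pick S i < dim_row A" by auto
  note C = row_submatrix_carrier[OF assms(1)]
  show ?thesis
  proof (rule eq_vecI)
    show "dim_vec (row (row_submatrix A S) i) = dim_vec (row A (pick S i))" using C by auto
    fix j assume "j < dim_vec (row A (pick S i))"
    hence j: "j < dim_col A" by simp
    have "row (row_submatrix A S) i $ j = row_submatrix A S $$ (i, j)" using C j assms(2) by simp
    also have "\<dots> = A $$ (pick S i, pick UNIV j)"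
      unfolding row_submatrix_def by (rule submatrix_index) (use S assms(2) j in simp_all)
    finally show "row (row_submatrix A S) i $ j = row A (pick S i) $ j"
      using p' j by (simp add: pick_UNIV)
  qed
qed

lemma LP_coeffs_scalar_prod:
  assumes "r \<in> carrier_vec n" "s \<in> carrier_vec q" "xp \<in> carrier_vec n" "xm \<in> carrier_vec n"
    "yp \<in> carrier_vec q" "ym \<in> carrier_vec q"
  shows "LP_coeffs r s \<bullet> LP_stack (xp, xm, yp, ym) = r \<bullet> (xp - xm) - s \<bullet> (yp - ym)"
proof -
  have "LP_coeffs r s \<bullet> LP_stack (xp, xm, yp, ym)
      = (r @\<^sub>v - r) \<bullet> (xp @\<^sub>v xm) + (- s @\<^sub>v s) \<bullet> (yp @\<^sub>v ym)"
    unfolding LP_coeffs_def LP_stack_def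
    by (simp, rule scalar_prod_append[where ?n1.0 = "n + n" and ?n2.0 = "q + q"]) (use assms in auto)
  also have "(r @\<^sub>v - r) \<bullet> (xp @\<^sub>v xm) = r \<bullet> xp + (- r) \<bullet> xm"
    by (rule scalar_prod_append) (use assms in auto)
  also have "(- s @\<^sub>v s) \<bullet> (yp @\<^sub>v ym) = (- s) \<bullet> yp + s \<bullet> ym"
    by (rule scalar_prod_append) (use assms in auto)
  finally show ?thesis
    using assms by (simp add: scalar_prod_minus_distrib)
qed

lemma zero_le_append_vec:
  assumes "v \<in> carrier_vec a" and "w \<in> carrier_vec b"
  shows "0\<^sub>v (a + b) \<le> v @\<^sub>v w \<longleftrightarrow> 0\<^sub>v a \<le> v \<and> 0\<^sub>v b \<le> (w :: real vec)"
proof -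
  have "0\<^sub>v (a + b) = 0\<^sub>v a @\<^sub>v (0\<^sub>v b :: real vec)" by auto
  thus ?thesis using append_vec_le[of "0\<^sub>v a" a v "0\<^sub>v b" w] assms by simp
qed

lemma LP_polyhedron_iff:
  fixes A :: "real mat" and k :: nat and I :: "nat set"
  defines "n \<equiv> dim_col A" and "q \<equiv> card ({..<dim_row A} - I)"
  assumes k: "k < dim_row A" and I: "I \<subseteq> {..<dim_row A}"
    and c: "xp \<in> carrier_vec n" "xm \<in> carrier_vec n" "yp \<in> carrier_vec q" "ym \<in> carrier_vec q"
  shows "LP_stack (xp, xm, yp, ym) \<in> polyhedron (LP_dim A I) (LP_eqs A k I) (LP_ineqs A I)
    \<longleftrightarrow> LP_feasible A k I (xp, xm, yp, ym)"
proof -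
  let ?z = "LP_stack (xp, xm, yp, ym)"
  let ?J = "{..<dim_row A} - I"
  have p: "LP_dim A I = (n + n) + (q + q)" unfolding LP_dim_def n_def q_def by simp
  have z: "?z \<in> carrier_vec (LP_dim A I)" unfolding p LP_stack_def using c by auto
  have MJ: "row_submatrix A ?J \<in> carrier_mat q n"
    unfolding n_def q_def by (rule row_submatrix_carrier) auto
  have MI: "row_submatrix A I \<in> carrier_mat (card I) n"
    unfolding n_def by (rule row_submatrix_carrier[OF I])
  have rJ: "row (row_submatrix A ?J) j \<in> carrier_vec n" for j using MJ by auto
  have rI: "row (row_submatrix A I) j \<in> carrier_vec n" for j using MI by auto
  have rk: "row A k \<in> carrier_vec n" unfolding n_def by auto
  have eJ: "(\<forall>j<q. LP_coeffs (row (row_submatrix A ?J) j) (unit_vec q j) \<bullet> ?z = 0)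
      \<longleftrightarrow> row_submatrix A ?J *\<^sub>v (xp - xm) = yp - ym"
  proof -
    have "LP_coeffs (row (row_submatrix A ?J) j) (unit_vec q j) \<bullet> ?z
        = (row_submatrix A ?J *\<^sub>v (xp - xm)) $ j - (yp - ym) $ j" if "j < q" for j
      using LP_coeffs_scalar_prod[OF rJ unit_vec_carrier c] that MJ c by simp
    thus ?thesis using MJ c by (auto simp: vec_eq_iff)
  qed
  have ek: "LP_coeffs (row A k) (0\<^sub>v q) \<bullet> ?z = row A k \<bullet> (xp - xm)"
    using LP_coeffs_scalar_prod[OF rk zero_carrier_vec c] c by simp
  have eI: "(\<forall>i<card I. LP_coeffs (row (row_submatrix A I) i) (0\<^sub>v q) \<bullet> ?z = 0)
      \<longleftrightarrow> row_submatrix A I *\<^sub>v (xp - xm) = 0\<^sub>v (card I)"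
    using LP_coeffs_scalar_prod[OF rI zero_carrier_vec c] MI c by (auto simp: vec_eq_iff)
  have "(\<forall>(a, b) \<in> LP_ineqs A I. a \<bullet> ?z \<ge> b)
      \<longleftrightarrow> (\<forall>j < LP_dim A I. unit_vec (LP_dim A I) j \<bullet> ?z \<ge> 0)"
    unfolding LP_ineqs_def by blast
  also have "\<dots> \<longleftrightarrow> 0\<^sub>v (LP_dim A I) \<le> ?z"
    using z unfolding less_eq_vec_def by simp
  also have "\<dots> \<longleftrightarrow> 0\<^sub>v n \<le> xp \<and> 0\<^sub>v n \<le> xm \<and> 0\<^sub>v q \<le> yp \<and> 0\<^sub>v q \<le> ym"
    unfolding p LP_stack_def using c by (simp add: zero_le_append_vec)
  finally have e0: "(\<forall>(a, b) \<in> LP_ineqs A I. a \<bullet> ?z \<ge> b) \<longleftrightarrow> \<dots>" .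
  have "(\<forall>(a, b) \<in> LP_eqs A k I. a \<bullet> ?z = b) \<longleftrightarrow>
      row_submatrix A ?J *\<^sub>v (xp - xm) = yp - ym \<and> row A k \<bullet> (xp - xm) = 1 \<and>
      row_submatrix A I *\<^sub>v (xp - xm) = 0\<^sub>v (card I)"
    unfolding eJ[symmetric] eI[symmetric] ek[symmetric]
    unfolding LP_eqs_def Let_def q_def[symmetric] ball_Un by fastforce
  thus ?thesis
    unfolding polyhedron_def LP_feasible_def Let_def prod.case n_def[symmetric] q_def[symmetric]
    using e0 z c by auto
qed

end

theory Submission
  imports Defs
begin

text \<open>
  Call \<open>x\<close> with \<open>A(k,:)x = 1\<close> rigid if the zeros of \<open>x\<close> and of \<open>A x\<close>, together with the normalization,
  determine \<open>x\<close>. For totally unimodular \<open>A\<close> every entry of \<open>A x\<close> at a rigid point is \<open>-1\<close>, \<open>0\<close> or \<open>1\<close>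
  (\<open>rigid_row_values\<close>), so that the 1-norm and the number of nonzero entries of any part of \<open>A x\<close>
  coincide. Rigid points arise in two ways.

  First, a basic feasible solution of the linear program gives a rigid \<open>x = x\<^sub>+ - x\<^sub>-\<close>: a direction that
  respects the zeros of \<open>x\<close> and of \<open>A x\<close> lifts to a direction in the stacked variables along
  which all active constraints stay tight, and at a basic solution only \<open>0\<close> is such a direction
  (\<open>LP_basic_solution_rigid\<close>). Second, from any \<open>w\<close> feasible for the cardinality problem one reaches
  a rigid feasible \<open>w'\<close> at which every zero of \<open>A w\<close> persists, by cancelling coordinates of \<open>w\<close> one
  after the other (\<open>exists_rigid\<close>).

  Writing \<open>B\<close> for the rows of \<open>A\<close> outside \<open>I\<close>, optimality in the linear program compares the two:
  \<open>\<parallel>B x\<parallel>\<^sub>0 = \<parallel>B x\<parallel>\<^sub>1 \<le> \<parallel>B w'\<parallel>\<^sub>1 = \<parallel>B w'\<parallel>\<^sub>0 \<le> \<parallel>B w\<parallel>\<^sub>0\<close>.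

  The values at a rigid point come from a largest nonsingular submatrix with rows where \<open>A x\<close>
  vanishes and columns where \<open>x\<close> does not. The cofactors of a bordering row form a vector \<open>v\<close> whose
  product with any row of \<open>A\<close> is again a minor of \<open>A\<close>; maximality makes these minors vanish wherever
  \<open>A x\<close> does, and rigidity makes \<open>x\<close> a multiple of \<open>v\<close>.
\<close>

section \<open>Minors of a totally unimodular matrix\<close>

text \<open>
  Rows and columns are selected by arbitrary functions rather than by sets, so that a minor can be
  bordered by a row and a column without tracking their position in the increasing order.
\<close>

definition indexed_minor :: "real mat \<Rightarrow> (nat \<Rightarrow> nat) \<Rightarrow> (nat \<Rightarrow> nat) \<Rightarrow> nat \<Rightarrow> real" where
  "indexed_minor A f g t = det (mat t t (\<lambda>(i, j). A $$ (f i, g j)))"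

lemma indexed_minor_transpose:
  assumes "\<And>i. i < t \<Longrightarrow> f i < dim_row A" "\<And>j. j < t \<Longrightarrow> g j < dim_col A"
  shows "indexed_minor A\<^sup>T g f t = indexed_minor A f g t"
proof -
  have "mat t t (\<lambda>(i, j). A\<^sup>T $$ (g i, f j)) = (mat t t (\<lambda>(i, j). A $$ (f i, g j)))\<^sup>T"
    by (rule eq_matI) (use assms in auto)
  thus ?thesis unfolding indexed_minor_def
    using det_transpose[of "mat t t (\<lambda>(i, j). A $$ (f i, g j))" t] by simp
qed

lemma indexed_minor_not_inj_rows:
  assumes "\<not> inj_on f {..<t}"
  shows "indexed_minor A f g t = 0"
proof -
  from assms obtain i j where ij: "i < t" "j < t" "i \<noteq> j" "f i = f j" by (auto simp: inj_on_def)
  show ?thesis unfolding indexed_minor_def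
    by (rule det_identical_rows[of _ t i j]) (use ij in auto)
qed

lemma indexed_minor_not_inj_cols:
  assumes "\<not> inj_on g {..<t}"
  shows "indexed_minor A f g t = 0"
proof -
  from assms obtain i j where ij: "i < t" "j < t" "i \<noteq> j" "g i = g j" by (auto simp: inj_on_def)
  show ?thesis unfolding indexed_minor_def
    by (rule det_identical_columns[of _ t i j]) (use ij in auto)
qed

lemma bij_betw_pick:
  assumes "finite S"
  shows "bij_betw (pick S) {..<card S} S"
proof -
  have "inj_on (pick S) {..<card S}"
  proof (rule inj_onI)
    fix a b assume ab: "a \<in> {..<card S}" "b \<in> {..<card S}" and e: "pick S a = pick S b"
    have "card {c \<in> S. c < pick S a} = a" "card {c \<in> S. c < pick S b} = b"
      using ab by (auto intro: card_pick_le)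
    thus "a = b" unfolding e by (rule box_equals[OF refl])
  qed
  moreover have "pick S ` {..<card S} \<subseteq> S" using pick_in_set_le by auto
  ultimately show ?thesis unfolding bij_betw_def
    using assms by (simp add: card_image card_subset_eq)
qed

text \<open>
  An injective selection of rows differs from the increasing enumeration of its range by a
  permutation, which costs only a sign.
\<close>

lemma indexed_minor_sort_rows:
  assumes inj: "inj_on f {..<t}"
  shows "\<exists>s\<in>{-1, 1}. indexed_minor A f g t = s * indexed_minor A (pick (f ` {..<t})) g t"
proof -
  let ?R = "f ` {..<t}"
  have cR: "card ?R = t" using inj by (simp add: card_image)
  have bp: "bij_betw (pick ?R) {..<t} ?R" using bij_betw_pick[of ?R] cR by simp
  define p where "p i = (if i < t then the_inv_into {..<t} (pick ?R) (f i) else i)" for i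
  have "bij_betw (the_inv_into {..<t} (pick ?R) \<circ> f) {..<t} {..<t}"
    by (rule bij_betw_trans[OF _ bij_betw_the_inv_into[OF bp]]) (use inj in \<open>simp add: bij_betw_def\<close>)
  hence "bij_betw p {..<t} {..<t}"
    by (rule bij_betw_cong[THEN iffD1, rotated]) (simp add: p_def)
  hence p: "p permutes {0..<t}"
    by (intro bij_imp_permutes) (auto simp: p_def lessThan_atLeast0)
  have pk: "pick ?R (p i) = f i" if "i < t" for i
    using that bp by (auto simp: p_def bij_betw_def intro!: f_the_inv_into_f)
  have pl: "p i < t" if "i < t" for i using p that by (metis atLeastLessThan_iff permutes_in_image zero_le)
  let ?M = "mat t t (\<lambda>(i, j). A $$ (pick ?R i, g j))"
  have "mat t t (\<lambda>(i, j). A $$ (f i, g j)) = mat t t (\<lambda>(i, j). ?M $$ (p i, j))"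
    by (rule eq_matI) (simp_all add: pk pl)
  hence "indexed_minor A f g t = signof p * det ?M"
    unfolding indexed_minor_def using det_permute_rows[OF _ p, of ?M] by simp
  moreover have "(signof p :: real) \<in> {-1, 1}" by (simp add: sign_def)
  ultimately show ?thesis unfolding indexed_minor_def by blast
qed

text \<open>
  A repeated row or column gives \<open>0\<close>; otherwise sorting rows and columns leads, up to sign, to the
  determinant of a genuine submatrix. Columns are sorted by passing to the transpose.
\<close>

lemma totally_unimodular_indexed_minor:
  assumes tu: "totally_unimodular A"
    and f: "\<And>i. i < t \<Longrightarrow> f i < dim_row A" and g: "\<And>j. j < t \<Longrightarrow> g j < dim_col A"
  shows "indexed_minor A f g t \<in> {-1, 0, 1}"
proof (cases "inj_on f {..<t} \<and> inj_on g {..<t}")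
  case False
  hence "indexed_minor A f g t = 0"
    using indexed_minor_not_inj_rows[of f t A g] indexed_minor_not_inj_cols[of g t A f] by argo
  thus ?thesis by simp
next
  case True
  hence inj: "inj_on f {..<t}" "inj_on g {..<t}" by auto
  let ?R = "f ` {..<t}" and ?C = "g ` {..<t}"
  have c: "card ?R = t" "card ?C = t" using inj by (simp_all add: card_image)
  have sub: "?R \<subseteq> {..<dim_row A}" "?C \<subseteq> {..<dim_col A}" using f g by auto
  have R: "pick ?R i < dim_row A" if "i < t" for i
    using pick_in_set_le[of i ?R] that c sub by auto
  have C: "pick ?C i < dim_col A" if "i < t" for i
    using pick_in_set_le[of i ?C] that c sub by auto
  obtain s where s: "s \<in> {-1, 1}" "indexed_minor A f g t = s * indexed_minor A (pick ?R) g t"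
    using indexed_minor_sort_rows[OF inj(1)] by blast
  obtain s' where s': "s' \<in> {-1, 1}"
      "indexed_minor A\<^sup>T g (pick ?R) t = s' * indexed_minor A\<^sup>T (pick ?C) (pick ?R) t"
    using indexed_minor_sort_rows[OF inj(2)] by blast
  have e: "indexed_minor A f g t = s * (s' * indexed_minor A (pick ?R) (pick ?C) t)"
    using s(2) s'(2) by (simp add: indexed_minor_transpose R C g)
  have RA: "{i. i < dim_row A \<and> i \<in> ?R} = ?R" and CA: "{j. j < dim_col A \<and> j \<in> ?C} = ?C"
    using sub by auto
  have "submatrix A ?R ?C = mat t t (\<lambda>(i, j). A $$ (pick ?R i, pick ?C j))"
    by (rule eq_matI) (simp_all add: dim_submatrix submatrix_index RA CA c)
  moreover have "det (submatrix A ?R ?C) \<in> {-1, 0, 1}"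
    using tu sub c unfolding totally_unimodular_def by simp
  ultimately have "indexed_minor A (pick ?R) (pick ?C) t \<in> {-1, 0, 1}"
    unfolding indexed_minor_def by simp
  moreover have "s * (s' * r) \<in> {-1, 0, 1}" if "r \<in> {-1, 0, 1}" for r
    using s(1) s'(1) that by (elim insertE emptyE) simp_all
  ultimately show ?thesis unfolding e by blast
qed

section \<open>Bordered minors\<close>

text \<open>
  Border the minor by column \<open>c\<close> and a row \<open>i\<close>, and expand along that row: the cofactors do not
  involve \<open>i\<close>, so a single vector of cofactors represents all these bordered minors at once, as its
  products with the rows of \<open>A\<close>. Its entry at \<open>c\<close> is the original minor.
\<close>

lemma bordered_minor_vec:
  assumes A: "A \<in> carrier_mat m n"
    and g: "\<And>j. j < t \<Longrightarrow> g j < n" and c: "c < n" "c \<notin> g ` {..<t}"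
  obtains v where "v \<in> carrier_vec n" "v $ c = indexed_minor A f g t"
    "\<And>l. l < n \<Longrightarrow> l \<notin> insert c (g ` {..<t}) \<Longrightarrow> v $ l = 0"
    "\<And>i. i < m \<Longrightarrow> row A i \<bullet> v = indexed_minor A (f(t := i)) (g(t := c)) (Suc t)"
proof -
  let ?g = "g(t := c)"
  define M where "M i = mat (Suc t) (Suc t) (\<lambda>(a, b). A $$ ((f(t := i)) a, ?g b))" for i
  define K where "K j = cofactor (M 0) t j" for j
  have K: "cofactor (M i) t j = K j" for i j
  proof -
    have "mat_delete (M i) t j = mat_delete (M 0) t j"
      by (rule eq_matI) (auto simp: M_def mat_delete_def)
    thus ?thesis by (simp add: K_def cofactor_def)
  qed
  have Kt: "K t = indexed_minor A f g t"
  proof -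
    have "mat_delete (M 0) t t = mat t t (\<lambda>(i, j). A $$ (f i, g j))"
      by (rule eq_matI) (auto simp: M_def mat_delete_def)
    thus ?thesis by (simp add: K_def cofactor_def indexed_minor_def)
  qed
  \<comment> \<open>The sum spares an inverse of the column selection, and works even if that selection is not injective.\<close>
  define v where "v = vec n (\<lambda>l. \<Sum>j<Suc t. if ?g j = l then K j else 0)"
  have gl: "?g j < n" if "j < Suc t" for j using that g c(1) by auto
  show ?thesis
  proof
    show "v \<in> carrier_vec n" by (simp add: v_def)
    have "(\<Sum>j<t. if ?g j = c then K j else 0) = 0"
      by (rule sum.neutral) (use c(2) in auto)
    thus "v $ c = indexed_minor A f g t" using c(1) by (simp add: v_def Kt)
    show "v $ l = 0" if "l < n" "l \<notin> insert c (g ` {..<t})" for l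
    proof -
      have "(\<Sum>j<Suc t. if ?g j = l then K j else 0) = 0"
        by (rule sum.neutral) (use that in auto)
      thus ?thesis using that by (simp add: v_def)
    qed
    show "row A i \<bullet> v = indexed_minor A (f(t := i)) ?g (Suc t)" if i: "i < m" for i
    proof -
      have "row A i \<bullet> v = (\<Sum>l<n. A $$ (i, l) * (\<Sum>j<Suc t. if ?g j = l then K j else 0))"
        using A i by (simp add: scalar_prod_def v_def lessThan_atLeast0 del: sum.lessThan_Suc)
      also have "\<dots> = (\<Sum>j<Suc t. \<Sum>l<n. if ?g j = l then A $$ (i, l) * K j else 0)"
        unfolding sum_distrib_left by (subst sum.swap) (simp add: if_distrib cong: if_cong)
      also have "\<dots> = (\<Sum>j<Suc t. A $$ (i, ?g j) * K j)"
        by (rule sum.cong) (use gl in \<open>simp_all add: sum.delta' sum.delta\<close>)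
      also have "\<dots> = (\<Sum>j<Suc t. M i $$ (t, j) * cofactor (M i) t j)"
        unfolding K by (rule sum.cong) (simp_all add: M_def)
      also have "\<dots> = det (M i)"
        by (rule laplace_expansion_row[symmetric]) (simp_all add: M_def)
      finally show ?thesis by (simp add: M_def indexed_minor_def)
    qed
  qed
qed

section \<open>Rigid points\<close>

text \<open>
  When \<open>A(k,:)x = 1\<close>, this says that \<open>x\<close> is a vertex of the arrangement formed by the coordinate
  hyperplanes and the row hyperplanes of \<open>A\<close> within the affine space \<open>A(k,:)x = 1\<close>.
\<close>

definition rigid :: "real mat \<Rightarrow> nat \<Rightarrow> real vec \<Rightarrow> bool" where
  "rigid A k x \<longleftrightarrow> (\<forall>v \<in> carrier_vec (dim_col A).
     (\<forall>j < dim_col A. x $ j = 0 \<longrightarrow> v $ j = 0) \<longrightarrow>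
     (\<forall>i < dim_row A. row A i \<bullet> x = 0 \<longrightarrow> row A i \<bullet> v = 0) \<longrightarrow>
     row A k \<bullet> v = 0 \<longrightarrow> v = 0\<^sub>v (dim_col A))"

text \<open>
  This is where total unimodularity enters. It replaces Cramer's rule on a square system
  defining \<open>x\<close>: a maximal nonzero minor and its border already produce a multiple of \<open>x\<close>, with the
  factor \<open>A(k,:)v\<close> itself a nonzero minor, hence \<open>1\<close> or \<open>-1\<close>.
\<close>

lemma rigid_row_values:
  assumes A: "A \<in> carrier_mat m n" and tu: "totally_unimodular A" and k: "k < m"
    and x: "x \<in> carrier_vec n" and kx: "row A k \<bullet> x = 1" and rigid: "rigid A k x" and i: "i < m"
  shows "row A i \<bullet> x \<in> {-1, 0, 1}"
proof -
  define Z where "Z = {i. i < m \<and> row A i \<bullet> x = 0}"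
  define C where "C = {j. j < n \<and> x $ j \<noteq> 0}"
  have finC: "finite C" by (simp add: C_def)
  have rA: "row A i \<in> carrier_vec n" for i using A by auto
  define P where "P t \<longleftrightarrow> (\<exists>f g. f ` {..<t} \<subseteq> Z \<and> g ` {..<t} \<subseteq> C \<and> indexed_minor A f g t \<noteq> 0)" for t
  have P0: "P 0" by (auto simp: P_def indexed_minor_def)
  have bound: "t \<le> card C" if "P t" for t
  proof -
    from that obtain f g where g: "g ` {..<t} \<subseteq> C" "indexed_minor A f g t \<noteq> 0"
      by (auto simp: P_def)
    hence "inj_on g {..<t}" using indexed_minor_not_inj_cols by blast
    thus ?thesis using card_mono[OF finC g(1)] by (simp add: card_image)
  qed
  have "\<exists>t. P t \<and> (\<forall>s. P s \<longrightarrow> s \<le> t)"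
    by (rule ex_has_greatest_nat[of P 0 "\<lambda>s. s" "Suc (card C)", OF P0])
      (simp add: bound less_Suc_eq_le)
  then obtain t where Pt: "P t" and max: "\<And>s. P s \<Longrightarrow> s \<le> t" by auto
  from Pt obtain f g where f: "f ` {..<t} \<subseteq> Z" and g: "g ` {..<t} \<subseteq> C"
    and D: "indexed_minor A f g t \<noteq> 0" by (auto simp: P_def)
  have injg: "inj_on g {..<t}" using D indexed_minor_not_inj_cols by blast
  \<comment> \<open>If the minor used all of the support of \<open>x\<close>, then \<open>x\<close> restricted to its support would be a nonzero
    kernel vector of a nonsingular matrix.\<close>
  have "g ` {..<t} \<noteq> C"
  proof
    assume gC: "g ` {..<t} = C"
    define M where "M = mat t t (\<lambda>(i, j). A $$ (f i, g j))"
    define h where "h = vec t (\<lambda>j. x $ g j)"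
    have "M *\<^sub>v h = 0\<^sub>v t"
    proof (rule eq_vecI)
      fix a assume "a < dim_vec (0\<^sub>v t :: real vec)"
      hence a: "a < t" by simp
      have fa: "f a < m" "row A (f a) \<bullet> x = 0" using f a by (auto simp: Z_def)
      have "(M *\<^sub>v h) $ a = (\<Sum>j<t. A $$ (f a, g j) * x $ g j)"
        using a by (simp add: M_def h_def scalar_prod_def lessThan_atLeast0)
      also have "\<dots> = (\<Sum>l\<in>C. A $$ (f a, l) * x $ l)"
        unfolding gC[symmetric] by (simp add: sum.reindex[OF injg])
      also have "\<dots> = (\<Sum>l<n. A $$ (f a, l) * x $ l)"
        by (rule sum.mono_neutral_left) (auto simp: C_def)
      also have "\<dots> = row A (f a) \<bullet> x"
        using A x fa by (simp add: scalar_prod_def lessThan_atLeast0)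
      finally show "(M *\<^sub>v h) $ a = 0\<^sub>v t $ a" using fa a by simp
    qed (simp add: M_def)
    moreover have "h \<noteq> 0\<^sub>v t"
    proof
      assume h0: "h = 0\<^sub>v t"
      have "t = 0"
      proof (rule ccontr)
        assume "t \<noteq> 0"
        hence "x $ g 0 \<noteq> 0" using g by (auto simp: C_def)
        moreover have "h $ 0 = 0" using h0 \<open>t \<noteq> 0\<close> by simp
        ultimately show False using \<open>t \<noteq> 0\<close> by (simp add: h_def)
      qed
      hence "C = {}" using gC by auto
      hence "x = 0\<^sub>v n" using x by (auto simp: C_def)
      thus False using kx rA[of k] by simp
    qed
    moreover have "M \<in> carrier_mat t t" "h \<in> carrier_vec t" by (simp_all add: M_def h_def)
    ultimately have "det M = 0" using det_0_iff_vec_prod_zero[of M t] by blast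
    thus False using D by (simp add: M_def indexed_minor_def)
  qed
  then obtain c where c: "c \<in> C" "c \<notin> g ` {..<t}" using g by auto
  obtain v where v: "v \<in> carrier_vec n" and vc: "v $ c = indexed_minor A f g t"
    and vs: "\<And>l. l < n \<Longrightarrow> l \<notin> insert c (g ` {..<t}) \<Longrightarrow> v $ l = 0"
    and vr: "\<And>i. i < m \<Longrightarrow> row A i \<bullet> v = indexed_minor A (f(t := i)) (g(t := c)) (Suc t)"
    by (rule bordered_minor_vec[OF A, of t g c f]) (use g c in \<open>auto simp: C_def\<close>)
  have vC: "v $ l = 0" if "l < n" "x $ l = 0" for l
    by (rule vs) (use that c g in \<open>auto simp: C_def\<close>)
  have gC': "(g(t := c)) ` {..<Suc t} \<subseteq> C" using g c by (auto simp: less_Suc_eq)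
  have vZ: "row A i \<bullet> v = 0" if "i < m" "row A i \<bullet> x = 0" for i
  proof (rule ccontr)
    assume "row A i \<bullet> v \<noteq> 0"
    moreover have "i \<in> Z" using that by (simp add: Z_def)
    hence "(f(t := i)) ` {..<Suc t} \<subseteq> Z" using f by (auto simp: less_Suc_eq)
    ultimately have "P (Suc t)" unfolding P_def using gC' vr[OF that(1)] by metis
    thus False using max by fastforce
  qed
  have vm: "row A i \<bullet> v \<in> {-1, 0, 1}" if "i < m" for i
    unfolding vr[OF that]
  proof (rule totally_unimodular_indexed_minor[OF tu])
    show "(f(t := i)) a < dim_row A" if "a < Suc t" for a
    proof (cases "a = t")
      case False
      hence "f a \<in> Z" using f that by auto
      thus ?thesis using False A by (simp add: Z_def)
    qed (use \<open>i < m\<close> A in simp)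
    show "(g(t := c)) b < dim_col A" if "b < Suc t" for b
    proof -
      have "(g(t := c)) b \<in> C" using gC' that by blast
      thus ?thesis using A by (simp add: C_def)
    qed
  qed
  have dims: "dim_row A = m" "dim_col A = n" using A by auto
  have rigidD: "u = 0\<^sub>v n" if "u \<in> carrier_vec n" "\<And>j. j < n \<Longrightarrow> x $ j = 0 \<Longrightarrow> u $ j = 0"
    "\<And>i. i < m \<Longrightarrow> row A i \<bullet> x = 0 \<Longrightarrow> row A i \<bullet> u = 0" "row A k \<bullet> u = 0" for u
    using rigid that unfolding rigid_def dims by blast
  have vn: "v \<noteq> 0\<^sub>v n" using vc D c by (auto simp: C_def)
  have kv: "row A k \<bullet> v \<noteq> 0" using rigidD[OF v vC vZ] vn by blast
  \<comment> \<open>The multiple of \<open>x\<close> is chosen to agree with \<open>v\<close> on row \<open>k\<close>, so rigidity annihilates the difference.\<close>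
  define u where "u = (row A k \<bullet> v) \<cdot>\<^sub>v x - v"
  have ru: "row A i \<bullet> u = (row A k \<bullet> v) * (row A i \<bullet> x) - row A i \<bullet> v" for i
    unfolding u_def using x v rA[of i]
    by (simp add: scalar_prod_minus_distrib[of _ n])
  have "u = 0\<^sub>v n"
    by (rule rigidD) (use x v vC vZ kx in \<open>simp_all add: ru, simp_all add: u_def\<close>)
  hence "(row A k \<bullet> v) * (row A i \<bullet> x) = row A i \<bullet> v"
    using ru[of i] rA[of i] by simp
  thus ?thesis using vm[OF k] vm[OF i] kv by auto
qed

text \<open>
  As long as \<open>x\<close> is not rigid, a nonzero direction \<open>v\<close> respects its zeros; subtracting the multiple
  of \<open>v\<close> that cancels one coordinate of \<open>x\<close> shrinks the support of \<open>x\<close> and creates no new nonzero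
  entry of \<open>A x\<close>.
\<close>

lemma exists_rigid:
  assumes A: "A \<in> carrier_mat m n" and x: "x \<in> carrier_vec n" and kx: "row A k \<bullet> x = 1"
  shows "\<exists>x' \<in> carrier_vec n. row A k \<bullet> x' = 1 \<and> rigid A k x' \<and>
    (\<forall>i < m. row A i \<bullet> x = 0 \<longrightarrow> row A i \<bullet> x' = 0)"
  using x kx
proof (induction "card {j. j < n \<and> x $ j \<noteq> 0}" arbitrary: x rule: less_induct)
  case less
  show ?case
  proof (cases "rigid A k x")
    case True
    thus ?thesis using less.prems by blast
  next
    case False
    have dims: "dim_row A = m" "dim_col A = n" using A by auto
    have rA: "row A i \<in> carrier_vec n" for i using A by auto
    from False obtain v where v: "v \<in> carrier_vec n" "v \<noteq> 0\<^sub>v n" "row A k \<bullet> v = 0"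
      and vC: "\<And>j. j < n \<Longrightarrow> x $ j = 0 \<Longrightarrow> v $ j = 0"
      and vZ: "\<And>i. i < m \<Longrightarrow> row A i \<bullet> x = 0 \<Longrightarrow> row A i \<bullet> v = 0"
      unfolding rigid_def dims by blast
    from v obtain j where j: "j < n" "v $ j \<noteq> 0" by (auto simp: vec_eq_iff)
    define y where "y = x - (x $ j / v $ j) \<cdot>\<^sub>v v"
    have y: "y \<in> carrier_vec n" using v less.prems by (simp add: y_def)
    have ry: "row A i \<bullet> y = row A i \<bullet> x - (x $ j / v $ j) * (row A i \<bullet> v)" for i
      unfolding y_def using less.prems(1) v(1) rA[of i] by (simp add: scalar_prod_minus_distrib[of _ n])
    have "{l. l < n \<and> y $ l \<noteq> 0} \<subset> {l. l < n \<and> x $ l \<noteq> 0}"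
    proof
      show "{l. l < n \<and> y $ l \<noteq> 0} \<subseteq> {l. l < n \<and> x $ l \<noteq> 0}"
        using vC v less.prems by (auto simp: y_def)
      have "y $ j = 0" "x $ j \<noteq> 0" using j v vC less.prems by (auto simp: y_def)
      thus "{l. l < n \<and> y $ l \<noteq> 0} \<noteq> {l. l < n \<and> x $ l \<noteq> 0}" using j by auto
    qed
    hence "card {l. l < n \<and> y $ l \<noteq> 0} < card {l. l < n \<and> x $ l \<noteq> 0}"
      by (intro psubset_card_mono) auto
    moreover have "row A k \<bullet> y = 1" using ry[of k] v(3) less.prems(2) by simp
    ultimately obtain x' where x': "x' \<in> carrier_vec n" "row A k \<bullet> x' = 1" "rigid A k x'"
      and y0: "\<And>i. i < m \<Longrightarrow> row A i \<bullet> y = 0 \<Longrightarrow> row A i \<bullet> x' = 0"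
      using less.hyps[OF _ y] by blast
    have "row A i \<bullet> x' = 0" if "i < m" "row A i \<bullet> x = 0" for i
      using y0[of i] ry[of i] vZ[of i] that by simp
    thus ?thesis using x' by blast
  qed
qed

section \<open>Basic feasible solutions of the linear program\<close>

text \<open>
  The \<open>p\<close> independent active constraints span the whole space, so a vector orthogonal to all of them
  is orthogonal to itself.
\<close>

lemma basic_solution_direction_zero:
  assumes bs: "basic_solution p E N x" and cE: "fst ` E \<subseteq> carrier_vec p" and cN: "fst ` N \<subseteq> carrier_vec p"
    and d: "d \<in> carrier_vec p" and act: "\<And>a b. (a, b) \<in> active_constrs E N x \<Longrightarrow> a \<bullet> d = 0"
  shows "d = 0\<^sub>v p"
proof -
  interpret vec_space "TYPE(real)" p .
  from bs obtain B where B: "B \<subseteq> active_constrs E N x" "finite B" "card B = p" "lin_indep_constrs p B"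
    unfolding basic_solution_def by blast
  let ?S = "fst ` B"
  have S: "?S \<subseteq> carrier_vec p" using B(1) cE cN by (force simp: active_constrs_def)
  have li: "lin_indpt ?S" and cS: "card ?S = p"
    using B(3,4) by (auto simp: lin_indep_constrs_def card_image)
  have "basis ?S"
    by (rule dim_li_is_basis) (use B(2) S li cS in \<open>auto simp: dim_is_n\<close>)
  hence span: "span ?S = carrier_vec p" by (simp add: basis_def)
  have "d \<in> orthogonal_complement ?S"
    unfolding orthogonal_complement_def
  proof (intro CollectI conjI ballI d)
    fix y assume "y \<in> ?S"
    then obtain b where "(y, b) \<in> active_constrs E N x" using B(1) by auto
    from act[OF this] show "d \<bullet> y = 0"
      using \<open>y \<in> ?S\<close> S d by (simp add: comm_scalar_prod[of d p y] subset_iff)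
  qed
  hence "d \<in> orthogonal_complement (span ?S)" using in_orthogonal_complement_span[OF S] by simp
  hence "d \<bullet> d = 0" using span d by (simp add: orthogonal_complement_def)
  thus ?thesis using d by (auto simp: scalar_prod_def sum_nonneg_eq_0_iff)
qed

lemma row_submatrix_mult_vec_index:
  assumes "S \<subseteq> {..<dim_row A}" "j < card S"
  shows "(row_submatrix A S *\<^sub>v x) $ j = row A (pick S j) \<bullet> x"
  using row_submatrix_carrier[OF assms(1)] assms by (simp add: row_submatrix_row)

text \<open>
  A direction \<open>v\<close> changes \<open>x\<^sub>+ - x\<^sub>-\<close> by \<open>v\<close> if its whole coordinate is placed on \<open>x\<^sub>+\<close> where \<open>x\<^sub>+\<close> is
  nonzero, and, negated, on \<open>x\<^sub>-\<close> elsewhere. In the second case \<open>x\<^sub>-\<close> is nonzero unless \<open>x\<close> vanishes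
  there, and then so does \<open>v\<close>. Hence no active sign constraint is disturbed. The same splitting
  serves \<open>y\<^sub>+ - y\<^sub>-\<close>.
\<close>

lemma LP_basic_solution_rigid:
  assumes A: "A \<in> carrier_mat m n" and I: "I \<subseteq> {..<m}"
    and feas: "LP_feasible A k I (xp, xm, yp, ym)"
    and bs: "basic_solution (LP_dim A I) (LP_eqs A k I) (LP_ineqs A I) (LP_stack (xp, xm, yp, ym))"
  shows "rigid A k (xp - xm)"
proof -
  have dims: "dim_row A = m" "dim_col A = n" using A by auto
  define J where "J = {..<m} - I"
  define q where "q = card J"
  have J: "J \<subseteq> {..<dim_row A}" and I': "I \<subseteq> {..<dim_row A}" using I dims by (auto simp: J_def)
  have c: "xp \<in> carrier_vec n" "xm \<in> carrier_vec n" "yp \<in> carrier_vec q" "ym \<in> carrier_vec q"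
    and eJ: "row_submatrix A J *\<^sub>v (xp - xm) = yp - ym"
    and eI: "row_submatrix A I *\<^sub>v (xp - xm) = 0\<^sub>v (card I)"
    using feas by (simp_all add: LP_feasible_def Let_def dims J_def q_def)
  have pJ: "pick J j < m" if "j < q" for j
    using pick_in_set_le[of j J] that J dims by (auto simp: q_def)
  have pI: "pick I j < m" if "j < card I" for j
    using pick_in_set_le[of j I] that I by auto
  have rA: "row A i \<in> carrier_vec n" for i using A by auto
  have p: "LP_dim A I = (n + n) + (q + q)" unfolding LP_dim_def dims J_def q_def by simp
  have rJ: "row (row_submatrix A J) j = row A (pick J j)" if "j < q" for j
    using row_submatrix_row[OF J] that by (simp add: q_def)
  have rI: "row (row_submatrix A I) j = row A (pick I j)" if "j < card I" for j
    using row_submatrix_row[OF I'] that by simp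
  show ?thesis unfolding rigid_def dims
  proof (intro ballI impI)
    fix v assume v: "v \<in> carrier_vec n"
      and vC: "\<forall>j<n. (xp - xm) $ j = 0 \<longrightarrow> v $ j = 0"
      and vZ: "\<forall>i<m. row A i \<bullet> (xp - xm) = 0 \<longrightarrow> row A i \<bullet> v = 0"
      and kv: "row A k \<bullet> v = 0"
    define u where "u = vec q (\<lambda>j. row A (pick J j) \<bullet> v)"
    have y: "(yp - ym) $ j = row A (pick J j) \<bullet> (xp - xm)" if "j < q" for j
      using row_submatrix_mult_vec_index[OF J, of j "xp - xm"] that eJ by (simp add: q_def)
    have uZ: "u $ j = 0" if "j < q" "(yp - ym) $ j = 0" for j
      using that y vZ pJ by (simp add: u_def)
    define dxp where "dxp = vec n (\<lambda>i. if xp $ i = 0 then 0 else v $ i)"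
    define dxm where "dxm = vec n (\<lambda>i. if xp $ i = 0 then - v $ i else 0)"
    define dyp where "dyp = vec q (\<lambda>i. if yp $ i = 0 then 0 else u $ i)"
    define dym where "dym = vec q (\<lambda>i. if yp $ i = 0 then - u $ i else 0)"
    have dc: "dxp \<in> carrier_vec n" "dxm \<in> carrier_vec n" "dyp \<in> carrier_vec q" "dym \<in> carrier_vec q"
      by (simp_all add: dxp_def dxm_def dyp_def dym_def)
    have dv: "dxp - dxm = v" using v by (auto simp: dxp_def dxm_def)
    have du: "dyp - dym = u" by (auto simp: dyp_def dym_def u_def)
    define d where "d = LP_stack (dxp, dxm, dyp, dym)"
    have dp: "d \<in> carrier_vec (LP_dim A I)" using dc by (simp add: d_def LP_stack_def p)
    have prod: "LP_coeffs r s \<bullet> d = r \<bullet> v - s \<bullet> u"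
      if "r \<in> carrier_vec n" "s \<in> carrier_vec q" for r s
      unfolding d_def using LP_coeffs_scalar_prod[OF that dc] by (simp add: dv du)
    have sx: "xp $ i = 0 \<longrightarrow> dxp $ i = 0" "xm $ i = 0 \<longrightarrow> dxm $ i = 0" if "i < n" for i
      using that vC c by (auto simp: dxp_def dxm_def)
    have sy: "yp $ i = 0 \<longrightarrow> dyp $ i = 0" "ym $ i = 0 \<longrightarrow> dym $ i = 0" if "i < q" for i
      using that uZ[of i] c by (auto simp: dyp_def dym_def)
    have "d = 0\<^sub>v (LP_dim A I)"
    proof (rule basic_solution_direction_zero[OF bs _ _ dp])
      show "fst ` LP_eqs A k I \<subseteq> carrier_vec (LP_dim A I)"
        using rA rI rJ p by (auto simp: LP_eqs_def LP_coeffs_def LP_stack_def Let_def dims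
          J_def[symmetric] q_def[symmetric])
      show "fst ` LP_ineqs A I \<subseteq> carrier_vec (LP_dim A I)" by (auto simp: LP_ineqs_def)
      fix a b assume "(a, b) \<in> active_constrs (LP_eqs A k I) (LP_ineqs A I) (LP_stack (xp, xm, yp, ym))"
      hence "(a, b) \<in> LP_eqs A k I \<union> LP_ineqs A I" and ab: "a \<bullet> LP_stack (xp, xm, yp, ym) = b"
        by (auto simp: active_constrs_def)
      then consider (J) j where "j < q" "a = LP_coeffs (row A (pick J j)) (unit_vec q j)"
        | (k) "a = LP_coeffs (row A k) (0\<^sub>v q)"
        | (I) j where "j < card I" "a = LP_coeffs (row A (pick I j)) (0\<^sub>v q)"
        | (N) j where "j < LP_dim A I" "a = unit_vec (LP_dim A I) j" "b = 0"
        using rJ rI by (auto simp: LP_eqs_def LP_ineqs_def Let_def dims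
          J_def[symmetric] q_def[symmetric])
      thus "a \<bullet> d = 0"
      proof cases
        case J
        thus ?thesis using prod[OF rA unit_vec_carrier] by (simp add: u_def)
      next
        case k
        thus ?thesis using prod[OF rA zero_carrier_vec] kv by (simp add: u_def)
      next
        case I
        have "row A (pick I j) \<bullet> (xp - xm) = 0"
          using row_submatrix_mult_vec_index[OF I' I(1), of "xp - xm"] eI I(1) by simp
        hence "row A (pick I j) \<bullet> v = 0" using vZ pI[OF I(1)] by blast
        thus ?thesis using I prod[OF rA zero_carrier_vec] by (simp add: u_def)
      next
        case N
        have "LP_stack (xp, xm, yp, ym) \<in> carrier_vec (LP_dim A I)"
          using c by (simp add: LP_stack_def p)
        hence "LP_stack (xp, xm, yp, ym) $ j = 0" using N ab by simp
        hence "d $ j = 0" using N(1) sx[of j] sx[of "j - n"] sy[of "j - n - n"] sy[of "j - n - n - q"] c dc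
          unfolding d_def LP_stack_def p by (auto split: if_splits)
        thus ?thesis using N dp by simp
      qed
    qed
    hence d0: "d $ j = 0" if "j < n + n" for j using that p by simp
    show "v = 0\<^sub>v n"
    proof (rule eq_vecI)
      fix i assume "i < dim_vec (0\<^sub>v n :: real vec)"
      hence i: "i < n" by simp
      have "dxp $ i = d $ i" "dxm $ i = d $ (n + i)"
        using i dc by (simp_all add: d_def LP_stack_def)
      hence "(dxp - dxm) $ i = 0" using d0[of i] d0[of "n + i"] i dc by simp
      thus "v $ i = 0\<^sub>v n $ i" using i dv by simp
    qed (use v in simp)
  qed
qed

section \<open>Comparing the two problems\<close>

lemma P0_feasible_LP_feasible:
  assumes A: "A \<in> carrier_mat m n" and J: "J = {..<m} - I" and x: "P0_feasible A k I x"
  obtains z where "LP_feasible A k I z"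
    "LP_objective A I z = (\<Sum>j<card J. \<bar>row A (pick J j) \<bullet> x\<bar>)"
proof -
  have dims: "dim_row A = m" "dim_col A = n" using A by auto
  have J': "J \<subseteq> {..<dim_row A}" by (auto simp: J dims)
  define q where "q = card J"
  define y where "y = row_submatrix A J *\<^sub>v x"
  define pos where "pos v = vec (dim_vec v) (\<lambda>i. max 0 (v $ i))" for v :: "real vec"
  define neg where "neg v = vec (dim_vec v) (\<lambda>i. max 0 (- v $ i))" for v :: "real vec"
  have xn: "x \<in> carrier_vec n" using x by (simp add: P0_feasible_def dims)
  have yq: "y \<in> carrier_vec q" using row_submatrix_carrier[OF J']
    by (intro carrier_vecI) (simp add: y_def q_def)
  have diff: "pos v - neg v = v" for v by (auto simp: pos_def neg_def)
  have c: "pos v \<in> carrier_vec (dim_vec v)" "0\<^sub>v (dim_vec v) \<le> pos v"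
    "neg v \<in> carrier_vec (dim_vec v)" "0\<^sub>v (dim_vec v) \<le> neg v" for v
    by (auto simp: pos_def neg_def less_eq_vec_def)
  have "LP_feasible A k I (pos x, neg x, pos y, neg y)"
    unfolding LP_feasible_def Let_def prod.case diff dims J[symmetric] q_def[symmetric]
    using c[of x] c[of y] xn yq x by (simp add: P0_feasible_def y_def[symmetric])
  moreover have "LP_objective A I (pos x, neg x, pos y, neg y) = (\<Sum>j<q. \<bar>row A (pick J j) \<bullet> x\<bar>)"
    unfolding LP_objective_def prod.case dims J[symmetric] q_def[symmetric]
  proof (rule sum.cong)
    fix j assume "j \<in> {..<q}"
    hence "j < q" by simp
    moreover from this have "y $ j = row A (pick J j) \<bullet> x"
      using row_submatrix_mult_vec_index[OF J'] by (simp add: y_def q_def)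
    ultimately show "pos y $ j + neg y $ j = \<bar>row A (pick J j) \<bullet> x\<bar>"
      using yq by (auto simp: pos_def neg_def)
  qed simp
  ultimately show ?thesis using that by (simp add: q_def)
qed

lemma norm0_row_submatrix:
  assumes "J \<subseteq> {..<dim_row A}"
  shows "norm0 (row_submatrix A J *\<^sub>v x) = card {j. j < card J \<and> row A (pick J j) \<bullet> x \<noteq> 0}"
proof -
  have "dim_vec (row_submatrix A J *\<^sub>v x) = card J" using row_submatrix_carrier[OF assms] by auto
  hence "{i. i < dim_vec (row_submatrix A J *\<^sub>v x) \<and> (row_submatrix A J *\<^sub>v x) $ i \<noteq> 0}
      = {j. j < card J \<and> row A (pick J j) \<bullet> x \<noteq> 0}"
    using row_submatrix_mult_vec_index[OF assms, of _ x] by (metis (lifting))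
  thus ?thesis unfolding norm0_def by simp
qed

lemma rigid_norm1_eq_norm0:
  assumes A: "A \<in> carrier_mat m n" and tu: "totally_unimodular A" and k: "k < m"
    and x: "x \<in> carrier_vec n" "row A k \<bullet> x = 1" "rigid A k x" and J: "J \<subseteq> {..<m}"
  shows "(\<Sum>j<card J. \<bar>row A (pick J j) \<bullet> x\<bar>) = norm0 (row_submatrix A J *\<^sub>v x)"
proof -
  have J': "J \<subseteq> {..<dim_row A}" using A J by auto
  have "(\<Sum>j<card J. \<bar>row A (pick J j) \<bullet> x\<bar>)
      = (\<Sum>j<card J. if row A (pick J j) \<bullet> x \<noteq> 0 then 1 else 0)"
  proof (rule sum.cong)
    fix j assume "j \<in> {..<card J}"
    hence "pick J j < m" using pick_in_set_le[of j J] J by auto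
    from rigid_row_values[OF A tu k x this]
    show "\<bar>row A (pick J j) \<bullet> x\<bar> = (if row A (pick J j) \<bullet> x \<noteq> 0 then 1 else 0)" by auto
  qed simp
  also have "\<dots> = card {j. j < card J \<and> row A (pick J j) \<bullet> x \<noteq> 0}"
    by (simp add: sum.If_cases Int_def)
  finally show ?thesis using norm0_row_submatrix[OF J'] by simp
qed

theorem mainTheorem1:
  fixes A :: "real mat" and m n k :: nat and I :: "nat set"
    and xp xm yp ym :: "real vec"
  assumes "A \<in> carrier_mat m n"
    and "totally_unimodular A"
    and "k < m"
    and "I \<subseteq> {..<m}"
    and "LP_optimal_bfs A k I (xp, xm, yp, ym)"
  shows "P0_optimal A k I (xp - xm)"
proof -
  note A = assms(1) and tu = assms(2) and k = assms(3) and I = assms(4)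
  have dims: "dim_row A = m" "dim_col A = n" using A by auto
  define J where "J = {..<m} - I"
  have J: "J \<subseteq> {..<m}" "J \<subseteq> {..<dim_row A}" by (auto simp: J_def dims)
  let ?x = "xp - xm"
  from assms(5) have bs: "basic_solution (LP_dim A I) (LP_eqs A k I) (LP_ineqs A I) (LP_stack (xp, xm, yp, ym))"
    and feas: "LP_feasible A k I (xp, xm, yp, ym)"
    and opt: "\<And>z. LP_feasible A k I z \<Longrightarrow> LP_objective A I (xp, xm, yp, ym) \<le> LP_objective A I z"
    unfolding LP_optimal_bfs_def basic_feasible_solution_def is_arg_min_linorder by blast+
  have xc: "?x \<in> carrier_vec n" and kx: "row A k \<bullet> ?x = 1"
    and eJ: "row_submatrix A J *\<^sub>v ?x = yp - ym"
    and y: "yp \<in> carrier_vec (card J)" "ym \<in> carrier_vec (card J)" "0\<^sub>v (card J) \<le> yp" "0\<^sub>v (card J) \<le> ym"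
    and xfeas: "P0_feasible A k I ?x"
    using feas by (simp_all add: LP_feasible_def P0_feasible_def Let_def dims J_def)
  have "norm0 (row_submatrix A J *\<^sub>v ?x) \<le> norm0 (row_submatrix A J *\<^sub>v w)" if w: "P0_feasible A k I w" for w
  proof -
    have wc: "w \<in> carrier_vec n" "row A k \<bullet> w = 1" using w by (simp_all add: P0_feasible_def dims)
    obtain w' where w': "w' \<in> carrier_vec n" "row A k \<bullet> w' = 1" "rigid A k w'"
      and zeros: "\<And>i. i < m \<Longrightarrow> row A i \<bullet> w = 0 \<Longrightarrow> row A i \<bullet> w' = 0"
      using exists_rigid[OF A wc] by blast
    have "row_submatrix A I *\<^sub>v w' = 0\<^sub>v (card I)"
    proof (rule eq_vecI)
      have I': "I \<subseteq> {..<dim_row A}" using I dims by simp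
      show "dim_vec (row_submatrix A I *\<^sub>v w') = dim_vec (0\<^sub>v (card I) :: real vec)"
        using row_submatrix_carrier[OF I'] by auto
      fix i assume "i < dim_vec (0\<^sub>v (card I) :: real vec)"
      hence i: "i < card I" by simp
      have "row A (pick I i) \<bullet> w = 0"
        using row_submatrix_mult_vec_index[OF I' i, of w] w i by (simp add: P0_feasible_def)
      moreover have "pick I i < m" using pick_in_set_le[OF i] I by auto
      ultimately show "(row_submatrix A I *\<^sub>v w') $ i = 0\<^sub>v (card I) $ i"
        using zeros row_submatrix_mult_vec_index[OF I' i, of w'] i by simp
    qed
    hence "P0_feasible A k I w'" using w' by (simp add: P0_feasible_def dims)
    then obtain z where z: "LP_feasible A k I z"
      "LP_objective A I z = (\<Sum>j<card J. \<bar>row A (pick J j) \<bullet> w'\<bar>)"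
      using P0_feasible_LP_feasible[OF A J_def] by blast
    have "real (norm0 (row_submatrix A J *\<^sub>v ?x)) = (\<Sum>j<card J. \<bar>row A (pick J j) \<bullet> ?x\<bar>)"
      using rigid_norm1_eq_norm0[OF A tu k xc kx LP_basic_solution_rigid[OF A I feas bs] J(1)] by simp
    also have "\<dots> \<le> (\<Sum>j<card J. yp $ j + ym $ j)"
    proof (rule sum_mono)
      fix j assume "j \<in> {..<card J}"
      hence j: "j < card J" by simp
      have "row A (pick J j) \<bullet> ?x = yp $ j - ym $ j"
        using row_submatrix_mult_vec_index[OF J(2) j, of ?x] eJ y j by simp
      moreover have "0 \<le> yp $ j" "0 \<le> ym $ j" using y j by (auto simp: less_eq_vec_def)
      ultimately show "\<bar>row A (pick J j) \<bullet> ?x\<bar> \<le> yp $ j + ym $ j" by simp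
    qed
    also have "\<dots> = LP_objective A I (xp, xm, yp, ym)" by (simp add: LP_objective_def dims J_def)
    also have "\<dots> \<le> LP_objective A I z" by (rule opt[OF z(1)])
    also have "\<dots> = norm0 (row_submatrix A J *\<^sub>v w')"
      using z(2) rigid_norm1_eq_norm0[OF A tu k w' J(1)] by simp
    also have "\<dots> \<le> norm0 (row_submatrix A J *\<^sub>v w)"
    proof -
      have "pick J j < m" if "j < card J" for j using pick_in_set_le[OF that] J by auto
      thus ?thesis unfolding norm0_row_submatrix[OF J(2)] of_nat_le_iff
        by (intro card_mono) (auto dest: zeros)
    qed
    finally show ?thesis by simp
  qed
  thus ?thesis unfolding P0_optimal_def is_arg_min_linorder dims J_def[symmetric] using xfeas by blast
qed

end
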